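(* Let $M\in\{0,\pm1\}^{m\times n}$ be a totally unimodular matrix and let $\mathcal{O}$ be the oriented matroid given by $M$. Let $k\ge 2$ and let $G$ be an Abelian group of order $k$. Then the following conditions are equivalent: (i) There exists an NL-$\mathbb{Z}_k$-flow in $\mathcal{O}$. (ii) There exists an NL-$G$-flow in $\mathcal{O}$. (iii) There exists an NL-$k$-flow in $\mathcal{O}$.
   Context: The oriented matroid $\mathcal{O}$ given by $M$ has ground set $E=\{1,\dots,n\}$ (the columns of $M$). Its covectors are the sign vectors of the elements of the real row space of $M$, and its vectors (the elements of $\mathcal{O}^\ast$) are the sign vectors of the elements of the real kernel of $M$. An oriented matroid is totally cyclic if the all-$+$ sign vector is one of its vectors. For $S\subseteq E$, $\mathcal{O}/S$ denotes contraction. Concretely, $\mathcal{O}/S$ is totally cyclic iff there is $z\in\mathbb{R}^n$ with $Mz=0$ and $z_e>0$ for all $e\in E\setminus S$. For an Abelian group $G$, a $G$-flow in $\mathcal{O}$ is a vector $x\in G^n$ with $Mx=0$ in $G^m$ (integer entries of $M$ acting on $G$ in the natural way). Its support is $\mathrm{supp}(x)=\{e\in E: x_e\ne 0\}$. An NL-$G$-flow is a $G$-flow $x\in G^n$ such that $\mathcal{O}/\mathrm{supp}(x)$ is totally cyclic. For an integer $k\ge2$, an NL-$k$-flow is an integer vector $x\in\{0,\pm1,\dots,\pm(k-1)\}^n$ with $Mx=0$ over $\mathbb{Z}$ such that $\mathcal{O}/\mathrm{supp}(x)$ is totally cyclic. $\mathbb{Z}_k=\mathbb{Z}/k\mathbb{Z}$.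 *)

theory Defs
  imports
    "HOL-Algebra.Elementary_Groups"
    "HOL-Library.FuncSet"
    "Jordan_Normal_Form.VS_Connect"
    "Jordan_Normal_Form.DL_Submatrix"
    "Jordan_Normal_Form.Matrix_Kernel"
begin

text \<open>
  Matrices are those of \<^typ>\<open>int mat\<close>, so rows and columns are numbered from 0, and
  zero rows or zero columns are allowed.
\<close>

definition totally_unimodular :: "int mat \<Rightarrow> bool" where
  "totally_unimodular M \<longleftrightarrow>
     (\<forall>I J. I \<subseteq> {..<dim_row M} \<longrightarrow> J \<subseteq> {..<dim_col M} \<longrightarrow> card I = card J \<longrightarrow>
        det (submatrix M I J) \<in> {-1, 0, 1})"

text \<open>
  A sign vector on a ground set \<open>E\<close> is an extensional function on \<open>E\<close> with values in
  \<open>{-1, 0, 1}\<close>. The record carries the covectors together with the vectors (the covectors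
  of the dual); for the oriented matroid of a real matrix both come from linear subspaces.
\<close>

type_synonym sign_vector = "nat \<Rightarrow> real"

record oriented_matroid =
  ground :: "nat set"
  covectors :: "sign_vector set"
  vectors :: "sign_vector set"

definition sign_of :: "real vec \<Rightarrow> sign_vector" where
  "sign_of z = (\<lambda>e\<in>{..<dim_vec z}. sgn (z $ e))"

definition om_of_mat :: "int mat \<Rightarrow> oriented_matroid" where
  "om_of_mat M =
     \<lparr> ground = {..<dim_col M},
       covectors = sign_of ` vec_space.row_space (dim_col M) (map_mat real_of_int M),
       vectors = sign_of ` mat_kernel (map_mat real_of_int M) \<rparr>"

text \<open>
  Contraction keeps the covectors that vanish on \<open>S\<close>; dually, since it is deletion in the
  dual, it restricts all vectors.
\<close>

definition contract :: "oriented_matroid \<Rightarrow> nat set \<Rightarrow> oriented_matroid" where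
  "contract Om S =
     \<lparr> ground = ground Om - S,
       covectors = {restrict X (ground Om - S) | X. X \<in> covectors Om \<and> (\<forall>e \<in> ground Om \<inter> S. X e = 0)},
       vectors = {restrict X (ground Om - S) | X. X \<in> vectors Om} \<rparr>"

definition totally_cyclic :: "oriented_matroid \<Rightarrow> bool" where
  "totally_cyclic Om \<longleftrightarrow> (\<lambda>e\<in>ground Om. 1) \<in> vectors Om"

lemma totally_cyclic_contract_om_of_mat:
  "totally_cyclic (contract (om_of_mat M) S) \<longleftrightarrow>
     (\<exists>z \<in> carrier_vec (dim_col M).
        map_mat real_of_int M *\<^sub>v z = 0\<^sub>v (dim_row M) \<and> (\<forall>e \<in> {..<dim_col M} - S. z $ e > 0))"
    (is "?L \<longleftrightarrow> ?R")
proof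
  assume ?L
  then obtain z where z: "z \<in> mat_kernel (map_mat real_of_int M)"
    and eq: "(\<lambda>e\<in>{..<dim_col M} - S. 1) = restrict (sign_of z) ({..<dim_col M} - S)"
    by (auto simp: totally_cyclic_def contract_def om_of_mat_def)
  have zc: "z \<in> carrier_vec (dim_col M)"
    using z by (simp add: mat_kernel_def)
  have "z $ e > 0" if e: "e \<in> {..<dim_col M} - S" for e
  proof -
    have "sgn (z $ e) = 1"
      using fun_cong[OF eq, of e] e zc by (simp add: sign_of_def)
    then show ?thesis by (simp add: sgn_1_pos)
  qed
  then show ?R using z zc by (auto simp: mat_kernel_def)
next
  assume ?R
  then obtain z where z: "z \<in> carrier_vec (dim_col M)"
    "map_mat real_of_int M *\<^sub>v z = 0\<^sub>v (dim_row M)"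
    and pos: "\<And>e. e \<in> {..<dim_col M} - S \<Longrightarrow> z $ e > 0" by blast
  have k: "z \<in> mat_kernel (map_mat real_of_int M)"
    using z by (simp add: mat_kernel_def)
  have eq: "(\<lambda>e\<in>{..<dim_col M} - S. 1) = restrict (sign_of z) ({..<dim_col M} - S)"
    using z(1) pos by (auto simp: sign_of_def restrict_def fun_eq_iff)
  show ?L
    unfolding totally_cyclic_def contract_def om_of_mat_def using k eq by auto
qed

text \<open>
  Abelian groups are written multiplicatively, so \<open>M x = 0\<close> reads, row by row, as a product of
  integer powers equal to the unit, and the support is where \<open>x\<close> differs from the unit.
\<close>

definition group_flow :: "('a, 'b) monoid_scheme \<Rightarrow> int mat \<Rightarrow> (nat \<Rightarrow> 'a) \<Rightarrow> bool" where
  "group_flow G M x \<longleftrightarrow>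
     x \<in> {..<dim_col M} \<rightarrow>\<^sub>E carrier G \<and>
     (\<forall>i<dim_row M. finprod G (\<lambda>e. x e [^]\<^bsub>G\<^esub> (M $$ (i, e))) {..<dim_col M} = \<one>\<^bsub>G\<^esub>)"

definition group_supp :: "('a, 'b) monoid_scheme \<Rightarrow> int mat \<Rightarrow> (nat \<Rightarrow> 'a) \<Rightarrow> nat set" where
  "group_supp G M x = {e. e < dim_col M \<and> x e \<noteq> \<one>\<^bsub>G\<^esub>}"

definition NL_group_flow :: "('a, 'b) monoid_scheme \<Rightarrow> int mat \<Rightarrow> (nat \<Rightarrow> 'a) \<Rightarrow> bool" where
  "NL_group_flow G M x \<longleftrightarrow>
     group_flow G M x \<and> totally_cyclic (contract (om_of_mat M) (group_supp G M x))"

definition int_supp :: "int vec \<Rightarrow> nat set" where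
  "int_supp x = {e. e < dim_vec x \<and> x $ e \<noteq> 0}"

definition NL_k_flow :: "nat \<Rightarrow> int mat \<Rightarrow> int vec \<Rightarrow> bool" where
  "NL_k_flow k M x \<longleftrightarrow>
     x \<in> carrier_vec (dim_col M) \<and>
     (\<forall>e<dim_col M. \<bar>x $ e\<bar> \<le> int k - 1) \<and>
     M *\<^sub>v x = 0\<^sub>v (dim_row M) \<and>
     totally_cyclic (contract (om_of_mat M) (int_supp x))"

end

theory Submission
  imports Defs
begin

text \<open>
  Total cyclicity of the contraction depends on a flow only through its support, so it suffices
  to match supports. In a totally unimodular matrix, a maximal nonsingular minor on a set \<open>T\<close> of
  columns yields a set \<open>B\<close> of columns that is an integral basis: the flows supported in \<open>T\<close> are
  the solutions of a system expressing the entries on \<open>B\<close> through arbitrary entries on \<open>T - B\<close>,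
  over every abelian group. Hence there are \<open>|G| ^ |T - B|\<close> of them, and by induction on \<open>S\<close> the
  number of \<open>G\<close>-flows with support exactly \<open>S\<close> depends only on \<open>|G|\<close>. For (iii), lift a
  \<open>\<int>\<^sub>k\<close>-flow to \<open>x\<close> with entries in \<open>{0..<k}\<close> and round \<open>x / k\<close> to an integer
  vector \<open>w\<close> with the same image under \<open>M\<close> (possible by total unimodularity); then \<open>x - k w\<close> is
  an integer flow with entries \<open>x\<^sub>e\<close> or \<open>x\<^sub>e - k\<close> and with the support of \<open>x\<close>.
\<close>

section \<open>Integral column bases\<close>

text \<open>
  Unlike \<^const>\<open>submatrix\<close>, the row and column selectors may be unsorted, so that bordering a
  minor needs no reindexing.
\<close>

definition submat_at :: "int mat \<Rightarrow> nat \<Rightarrow> (nat \<Rightarrow> nat) \<Rightarrow> (nat \<Rightarrow> nat) \<Rightarrow> int mat" where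
  "submat_at A p f g = mat p p (\<lambda>(i, j). A $$ (f i, g j))"

lemma submat_at_carrier [simp]: "submat_at A p f g \<in> carrier_mat p p"
  by (simp add: submat_at_def)

section \<open>Minors with unsorted row and column selectors\<close>

lemma submat_at_det_nonzero_inj:
  assumes "det (submat_at A p f g) \<noteq> 0"
  shows "inj_on f {..<p}" "inj_on g {..<p}"
proof -
  show "inj_on f {..<p}"
  proof (rule ccontr)
    assume "\<not> inj_on f {..<p}"
    then obtain i j where ij: "i < p" "j < p" "i \<noteq> j" "f i = f j"
      by (auto simp: inj_on_def)
    have "row (submat_at A p f g) i = row (submat_at A p f g) j"
      using ij by (auto simp: submat_at_def row_def)
    then have "det (submat_at A p f g) = 0"
      using det_identical_rows[OF submat_at_carrier] ij by blast
    then show False using assms by simp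
  qed
  show "inj_on g {..<p}"
  proof (rule ccontr)
    assume "\<not> inj_on g {..<p}"
    then obtain i j where ij: "i < p" "j < p" "i \<noteq> j" "g i = g j"
      by (auto simp: inj_on_def)
    have "row (transpose_mat (submat_at A p f g)) i = row (transpose_mat (submat_at A p f g)) j"
      using ij by (auto simp: submat_at_def row_def)
    then have "det (transpose_mat (submat_at A p f g)) = 0"
      using det_identical_rows[of "transpose_mat (submat_at A p f g)" p i j] ij by simp
    then show False using assms det_transpose[OF submat_at_carrier] by simp
  qed
qed

text \<open>\<open>q\<close> is the sorting permutation: it sends \<open>i\<close> to the rank of
  \<open>f i\<close> in the image, and \<open>pick\<close> recovers an element from its
  rank.\<close>

lemma inj_on_pick_permutes:
  fixes f :: "nat \<Rightarrow> nat"
  assumes "inj_on f {..<p}"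
  obtains q where "q permutes {0..<p}" "\<And>i. i < p \<Longrightarrow> f i = pick (f ` {..<p}) (q i)"
proof -
  let ?I = "f ` {..<p}"
  \<comment> \<open>Being the identity beyond \<open>p\<close> is what makes \<open>q\<close> a
    permutation of \<open>{0..<p}\<close> in the sense of \<open>permutes\<close>.\<close>
  define q where "q i = (if i < p then card {a \<in> ?I. a < f i} else i)" for i
  have pick: "f i = pick ?I (q i)" if "i < p" for i
    using that by (simp add: q_def pick_card_in_set)
  have "q i < p" if "i < p" for i
  proof -
    have "card {a \<in> ?I. a < f i} < card ?I"
      using that by (intro psubset_card_mono) auto
    then show ?thesis using that assms by (simp add: q_def card_image)
  qed
  then have "q ` {0..<p} \<subseteq> {0..<p}" by auto
  moreover have inj: "inj_on q {0..<p}"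
    using assms pick unfolding inj_on_def by (metis atLeastLessThan_iff lessThan_iff)
  ultimately have "bij_betw q {0..<p} {0..<p}"
    by (simp add: bij_betw_def endo_inj_surj)
  then have "q permutes {0..<p}"
    by (rule bij_imp_permutes) (simp add: q_def)
  then show thesis using that pick by blast
qed

text \<open>Sorting the rows costs only the sign of a permutation. Columns are sorted by the same
  lemma after transposition.\<close>

lemma abs_det_submat_at_pick:
  assumes "inj_on f {..<p}"
  shows "\<bar>det (submat_at A p f g)\<bar> = \<bar>det (submat_at A p (pick (f ` {..<p})) g)\<bar>"
proof -
  obtain q where q: "q permutes {0..<p}" "\<And>i. i < p \<Longrightarrow> f i = pick (f ` {..<p}) (q i)"
    using inj_on_pick_permutes[OF assms] by blast
  have "submat_at A p f g = mat p p (\<lambda>(i, j). submat_at A p (pick (f ` {..<p})) g $$ (q i, j))"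
    using q permutes_in_image[OF q(1)] by (auto simp: submat_at_def)
  then have "det (submat_at A p f g) = signof q * det (submat_at A p (pick (f ` {..<p})) g)"
    using det_permute_rows[OF submat_at_carrier q(1)] by simp
  then show ?thesis by (simp add: abs_mult sign_def)
qed

lemma det_submat_at_transpose:
  assumes "A \<in> carrier_mat m n" "f ` {..<p} \<subseteq> {..<m}" "g ` {..<p} \<subseteq> {..<n}"
  shows "det (submat_at (transpose_mat A) p g f) = det (submat_at A p f g)"
proof -
  have "submat_at (transpose_mat A) p g f = transpose_mat (submat_at A p f g)"
    using assms by (intro eq_matI) (auto simp: submat_at_def image_subset_iff)
  then show ?thesis by (simp add: det_transpose[OF submat_at_carrier])
qed

text \<open>Total unimodularity speaks of sorted submatrices. A nonzero determinant forces injective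
  selectors, so both index sets have size \<open>p\<close>; sorting rows and then columns preserves
  the absolute value.\<close>

lemma totally_unimodular_det_submat_at:
  assumes A: "A \<in> carrier_mat m n" and tu: "totally_unimodular A"
    and f: "f ` {..<p} \<subseteq> {..<m}" and g: "g ` {..<p} \<subseteq> {..<n}"
    and nz: "det (submat_at A p f g) \<noteq> 0"
  shows "\<bar>det (submat_at A p f g)\<bar> = 1"
proof -
  define I where "I = f ` {..<p}"
  define J where "J = g ` {..<p}"
  note inj = submat_at_det_nonzero_inj[OF nz]
  have cI: "card I = p" and cJ: "card J = p"
    using inj by (simp_all add: I_def J_def card_image)
  have I: "{i. i < m \<and> i \<in> I} = I" and J: "{i. i < n \<and> i \<in> J} = J"
    using f g by (auto simp: I_def J_def)
  have pI: "pick I ` {..<p} \<subseteq> {..<m}"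
    using pick_le[of _ m I] cI I by auto
  have pJ: "pick J ` {..<p} \<subseteq> {..<n}"
    using pick_le[of _ n J] cJ J by auto
  have "\<bar>det (submat_at A p f g)\<bar> = \<bar>det (submat_at A p (pick I) g)\<bar>"
    using abs_det_submat_at_pick[OF inj(1)] by (simp add: I_def)
  also have "\<dots> = \<bar>det (submat_at (transpose_mat A) p g (pick I))\<bar>"
    using det_submat_at_transpose[OF A pI g] by simp
  also have "\<dots> = \<bar>det (submat_at (transpose_mat A) p (pick J) (pick I))\<bar>"
    using abs_det_submat_at_pick[OF inj(2)] by (simp add: J_def)
  also have "\<dots> = \<bar>det (submat_at A p (pick I) (pick J))\<bar>"
    using det_submat_at_transpose[OF A pI pJ] by simp
  also have "submat_at A p (pick I) (pick J) = submatrix A I J"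
    using A cI cJ I J by (simp add: submat_at_def submatrix_def)
  finally have eq: "\<bar>det (submat_at A p f g)\<bar> = \<bar>det (submatrix A I J)\<bar>" .
  have "det (submatrix A I J) \<in> {-1, 0, 1}"
    using tu A f g cI cJ unfolding totally_unimodular_def I_def J_def by auto
  then show ?thesis using eq nz by auto
qed

section \<open>Bordered minors and Schur complements\<close>

lemma submat_at_bordered:
  "submat_at A (Suc p) (f(p := i)) (g(p := e)) =
     four_block_mat (submat_at A p f g) (mat p 1 (\<lambda>(j, _). A $$ (f j, e)))
       (mat 1 p (\<lambda>(_, j). A $$ (i, g j))) (mat 1 1 (\<lambda>_. A $$ (i, e)))"
  by (rule eq_matI) (auto simp: submat_at_def less_Suc_eq)

text \<open>A column operation of determinant 1 clears the block \<open>c\<close>. The inverse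
  \<open>K\<close> is an argument, so no division occurs and the formula is available over the
  integers. When \<open>det N\<close> is nonzero and the bordered determinant vanishes, it gives the
  corner entry in terms of the border.\<close>

lemma det_schur:
  fixes N :: "'a :: idom mat"
  assumes N: "N \<in> carrier_mat p p" and K: "K \<in> carrier_mat p p" and NK: "N * K = 1\<^sub>m p"
    and c: "c \<in> carrier_mat p 1" and r: "r \<in> carrier_mat 1 p" and a: "a \<in> carrier_mat 1 1"
  shows "det (four_block_mat N c r a) = det N * (a $$ (0, 0) - (r * (K * c)) $$ (0, 0))"
proof -
  let ?Y = "four_block_mat (1\<^sub>m p) (- (K * c)) (0\<^sub>m 1 p) (1\<^sub>m 1)"
  have Kc: "K * c \<in> carrier_mat p 1" using K c by auto
  have NKc: "N * (K * c) = c"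
    using assoc_mult_mat[OF N K c] NK c by simp
  have "four_block_mat N c r a * ?Y =
      four_block_mat (N * 1\<^sub>m p + c * 0\<^sub>m 1 p) (N * - (K * c) + c * 1\<^sub>m 1)
        (r * 1\<^sub>m p + a * 0\<^sub>m 1 p) (r * - (K * c) + a * 1\<^sub>m 1)"
    using mult_four_block_mat[OF N c r a, of "1\<^sub>m p" p "- (K * c)" 1 "0\<^sub>m 1 p" "1\<^sub>m 1"] Kc by simp
  also have "\<dots> = four_block_mat N (0\<^sub>m p 1) r (- (r * (K * c)) + a)"
  proof -
    have "N * - (K * c) = - c"
      using N Kc NKc by (subst uminus_mult_right_mat) auto
    then have "N * - (K * c) + c * 1\<^sub>m 1 = 0\<^sub>m p 1"
      using c uminus_l_inv_mat[OF c] by simp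
    moreover have "r * - (K * c) = - (r * (K * c))"
      using r Kc by (subst uminus_mult_right_mat) auto
    moreover have "r * 1\<^sub>m p + a * 0\<^sub>m 1 p = r" using r a by simp
    moreover have "N * 1\<^sub>m p + c * 0\<^sub>m 1 p = N" using N c by simp
    ultimately show ?thesis using a by simp
  qed
  finally have prod: "four_block_mat N c r a * ?Y = four_block_mat N (0\<^sub>m p 1) r (- (r * (K * c)) + a)" .
  have rKc: "r * (K * c) \<in> carrier_mat 1 1" using r Kc by auto
  have "det ?Y = 1"
    using det_four_block_mat_lower_left_zero[of "1\<^sub>m p" p "- (K * c)" 1 "0\<^sub>m 1 p" "1\<^sub>m 1"] Kc by simp
  moreover have "det (four_block_mat N c r a * ?Y) = det (four_block_mat N c r a) * det ?Y"
    by (rule det_mult[of _ "p + 1"]) (use N a in \<open>auto intro!: four_block_carrier_mat\<close>)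
  moreover have "det (four_block_mat N (0\<^sub>m p 1) r (- (r * (K * c)) + a))
      = det N * det (- (r * (K * c)) + a)"
    by (rule det_four_block_mat_upper_right_zero) (use N r a rKc in auto)
  moreover have "det (- (r * (K * c)) + a) = a $$ (0, 0) - (r * (K * c)) $$ (0, 0)"
    using a r c rKc by (subst det_single) auto
  ultimately show ?thesis using prod by simp
qed

text \<open>
  \<open>L\<close> is an integral left inverse of the columns \<open>B\<close>, and \<open>C\<close> holds the coordinates of the
  columns in \<open>F\<close> with respect to \<open>B\<close>.
\<close>

lemma totally_unimodular_column_basis:
  assumes A: "A \<in> carrier_mat m n" and tu: "totally_unimodular A" and F: "F \<subseteq> {..<n}"
  obtains B :: "nat set" and L C :: "nat \<Rightarrow> nat \<Rightarrow> int" where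
    "B \<subseteq> F"
    "\<And>b e. b \<in> B \<Longrightarrow> e \<in> F \<Longrightarrow> (\<Sum>i<m. L b i * A $$ (i, e)) = C b e"
    "\<And>b b'. b \<in> B \<Longrightarrow> b' \<in> B \<Longrightarrow> C b b' = of_bool (b = b')"
    "\<And>i e. i < m \<Longrightarrow> e \<in> F \<Longrightarrow> A $$ (i, e) = (\<Sum>b\<in>B. A $$ (i, b) * C b e)"
proof -
  \<comment> \<open>Nonsingular minors with columns in \<open>F\<close>. Their row selectors are
    injective, so their sizes are bounded by \<open>m\<close> and a largest one exists.\<close>
  define P where "P p \<longleftrightarrow> (\<exists>f g. f ` {..<p} \<subseteq> {..<m} \<and> g ` {..<p} \<subseteq> F \<and> det (submat_at A p f g) \<noteq> 0)" for p
  have P0: "P 0" by (auto simp: P_def submat_at_def)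
  have Pm: "p \<le> m" if "P p" for p
  proof -
    from that obtain f g where fg: "f ` {..<p} \<subseteq> {..<m}" "det (submat_at A p f g) \<noteq> 0"
      by (auto simp: P_def)
    from card_inj_on_le[OF submat_at_det_nonzero_inj(1)[OF fg(2)] fg(1)] show ?thesis by simp
  qed
  define p where "p = (GREATEST p. P p)"
  have "P p" and max: "\<And>q. P q \<Longrightarrow> q \<le> p"
    unfolding p_def using GreatestI_nat[of P 0 m] Greatest_le_nat[of P _ m] P0 Pm by blast+
  then obtain f g where f: "f ` {..<p} \<subseteq> {..<m}" and g: "g ` {..<p} \<subseteq> F"
    and nz: "det (submat_at A p f g) \<noteq> 0" by (auto simp: P_def)
  define N where "N = submat_at A p f g"
  \<comment> \<open>Since \<open>det N\<close> is 1 or -1, it is its own inverse, and this multiple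
    of the adjugate is an integral inverse of \<open>N\<close>.\<close>
  define K where "K = det N \<cdot>\<^sub>m adj_mat N"
  have N: "N \<in> carrier_mat p p" by (simp add: N_def)
  have K: "K \<in> carrier_mat p p" using adj_mat(1)[OF N] by (simp add: K_def)
  have dd: "det N * det N = 1"
    using totally_unimodular_det_submat_at[OF A tu f _ nz] g F unfolding N_def
    by (metis abs_mult_self_eq dual_order.trans mult_1)
  have "det N \<cdot>\<^sub>m (det N \<cdot>\<^sub>m 1\<^sub>m p) = 1\<^sub>m p"
    using dd by (intro eq_matI) (auto simp: mult.assoc[symmetric])
  then have NK: "N * K = 1\<^sub>m p" and KN: "K * N = 1\<^sub>m p"
    using adj_mat[OF N] N
    by (simp_all add: K_def mult_smult_distrib[of N p p] mult_smult_assoc_mat[of _ p p])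
  \<comment> \<open>The coordinates of column \<open>e\<close> in the selected columns, obtained by
    solving the system restricted to the rows selected by \<open>f\<close>.\<close>
  define \<gamma> where "\<gamma> j e = (\<Sum>l<p. K $$ (j, l) * A $$ (f l, e))" for j e
  have \<gamma>_g: "\<gamma> j (g j') = of_bool (j = j')" if "j < p" "j' < p" for j j'
  proof -
    have "(K * N) $$ (j, j') = \<gamma> j (g j')"
      using that K N by (auto simp: \<gamma>_def scalar_prod_def N_def submat_at_def lessThan_atLeast0 intro!: sum.cong)
    then show ?thesis using KN that by (simp split: if_splits)
  qed
  have expand: "A $$ (i, e) = (\<Sum>j<p. A $$ (i, g j) * \<gamma> j e)" if i: "i < m" and e: "e \<in> F" for i e
  proof -
    let ?c = "mat p 1 (\<lambda>(j, _). A $$ (f j, e))"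
    let ?r = "mat 1 p (\<lambda>(_, j). A $$ (i, g j))"
    let ?a = "mat 1 1 (\<lambda>_. A $$ (i, e))"
    \<comment> \<open>By maximality, the minor bordered by row \<open>i\<close> and column
      \<open>e\<close> is singular, whether or not they were already selected. Its Schur complement
      is therefore zero, which is the expansion sought.\<close>
    have "\<not> P (Suc p)" using max[of "Suc p"] by auto
    moreover have "(f(p := i)) ` {..<Suc p} \<subseteq> {..<m}" "(g(p := e)) ` {..<Suc p} \<subseteq> F"
      using f g i e by (auto simp: image_subset_iff less_Suc_eq)
    ultimately have "det (submat_at A (Suc p) (f(p := i)) (g(p := e))) = 0"
      unfolding P_def by blast
    then have "det (four_block_mat N ?c ?r ?a) = 0" by (simp only: submat_at_bordered N_def)
    then have "?a $$ (0, 0) = (?r * (K * ?c)) $$ (0, 0)"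
      using det_schur[OF N K NK, of ?c ?r ?a] nz by (simp add: N_def)
    also have "(?r * (K * ?c)) $$ (0, 0) = (\<Sum>j<p. A $$ (i, g j) * \<gamma> j e)"
      using K by (auto simp: \<gamma>_def scalar_prod_def lessThan_atLeast0 intro!: sum.cong)
    finally show ?thesis by simp
  qed
  have inj: "inj_on g {..<p}" using submat_at_det_nonzero_inj(2)[OF nz] .
  define idx where "idx = the_inv_into {..<p} g"
  have idx: "idx (g j) = j" if "j < p" for j
    using that inj by (simp add: idx_def the_inv_into_f_f)
  show thesis
  proof (rule that)
    show "g ` {..<p} \<subseteq> F" by (rule g)
    \<comment> \<open>The left inverse is \<open>K\<close> with its columns moved to the row
      positions given by \<open>f\<close> and zeros elsewhere.\<close>
    show "(\<Sum>i<m. (\<Sum>l<p. if f l = i then K $$ (idx b, l) else 0) * A $$ (i, e)) = \<gamma> (idx b) e"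
      if "b \<in> g ` {..<p}" "e \<in> F" for b e
    proof -
      have "(\<Sum>i<m. (\<Sum>l<p. if f l = i then K $$ (idx b, l) else 0) * A $$ (i, e)) =
          (\<Sum>l<p. \<Sum>i<m. if f l = i then K $$ (idx b, l) * A $$ (i, e) else 0)"
        by (subst sum.swap) (auto simp: sum_distrib_right if_distrib cong: if_cong intro!: sum.cong)
      also have "\<dots> = \<gamma> (idx b) e"
        using f by (auto simp: \<gamma>_def intro!: sum.cong)
      finally show ?thesis .
    qed
    show "\<gamma> (idx b) b' = of_bool (b = b')" if "b \<in> g ` {..<p}" "b' \<in> g ` {..<p}" for b b'
      using that idx \<gamma>_g by auto
    show "A $$ (i, e) = (\<Sum>b\<in>g ` {..<p}. A $$ (i, b) * \<gamma> (idx b) e)" if "i < m" "e \<in> F" for i e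
      using expand[OF that] inj idx by (simp add: sum.reindex)
  qed
qed

section \<open>Integral rounding\<close>

text \<open>Induction on the number of fractional coordinates. The columns at these coordinates are
  dependent, so \<open>u\<close> can move along a kernel vector supported there until one more
  coordinate becomes integral.\<close>

lemma totally_unimodular_rounding:
  fixes u :: "nat \<Rightarrow> real"
  assumes A: "A \<in> carrier_mat m n" and tu: "totally_unimodular A"
    and "\<And>i. i < m \<Longrightarrow> (\<Sum>e<n. real_of_int (A $$ (i, e)) * u e) \<in> \<int>"
  shows "\<exists>w :: nat \<Rightarrow> int.
    (\<forall>i<m. (\<Sum>e<n. real_of_int (A $$ (i, e)) * real_of_int (w e)) =
            (\<Sum>e<n. real_of_int (A $$ (i, e)) * u e)) \<and>
    (\<forall>e<n. \<lfloor>u e\<rfloor> \<le> w e \<and> w e \<le> \<lceil>u e\<rceil>)"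
  using assms(3)
proof (induction "card {e. e < n \<and> u e \<notin> \<int>}" arbitrary: u rule: less_induct)
  case less
  define F where "F = {e. e < n \<and> u e \<notin> \<int>}"
  have F: "F \<subseteq> {..<n}" and finF: "finite F" by (auto simp: F_def)
  obtain B L C where B: "B \<subseteq> F"
    and L: "\<And>b e. b \<in> B \<Longrightarrow> e \<in> F \<Longrightarrow> (\<Sum>i<m. L b i * A $$ (i, e)) = C b e"
    and C: "\<And>b b'. b \<in> B \<Longrightarrow> b' \<in> B \<Longrightarrow> C b b' = of_bool (b = b')"
    and span: "\<And>i e. i < m \<Longrightarrow> e \<in> F \<Longrightarrow> A $$ (i, e) = (\<Sum>b\<in>B. A $$ (i, b) * C b e)"
    by (rule totally_unimodular_column_basis[OF A tu F], rule that)
  have finB: "finite B" using B finF finite_subset by blast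
  have part: "(\<Sum>e\<in>F. real_of_int (A $$ (i, e)) * u e) \<in> \<int>" if "i < m" for i
  proof -
    have "(\<Sum>e\<in>F. real_of_int (A $$ (i, e)) * u e) = (\<Sum>e<n. real_of_int (A $$ (i, e)) * u e) -
        (\<Sum>e\<in>{..<n} - F. real_of_int (A $$ (i, e)) * u e)"
      using sum.subset_diff[OF F, of "\<lambda>e. real_of_int (A $$ (i, e)) * u e"] by simp
    moreover have "(\<Sum>e\<in>{..<n} - F. real_of_int (A $$ (i, e)) * u e) \<in> \<int>"
      by (intro Ints_sum Ints_mult) (auto simp: F_def)
    ultimately show ?thesis using less.prems[OF that] by simp
  qed
  \<comment> \<open>If all fractional columns were in the basis, \<open>L\<close> would express
    their entries as integer combinations of the integral sums in \<open>part\<close>, contradicting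
    the choice of \<open>F\<close>.\<close>
  have "u b \<in> \<int>" if "b \<in> B" "B = F" for b
  proof -
    have "u b = (\<Sum>e\<in>F. real_of_int (C b e) * u e)"
    proof -
      have "(\<Sum>e\<in>F. real_of_int (C b e) * u e) = (\<Sum>e\<in>F. if b = e then u e else 0)"
        using that C by (intro sum.cong) auto
      then show ?thesis using that finF by simp
    qed
    also have "\<dots> = (\<Sum>e\<in>F. real_of_int (\<Sum>i<m. L b i * A $$ (i, e)) * u e)"
      using L that by (intro sum.cong) auto
    also have "\<dots> = (\<Sum>i<m. real_of_int (L b i) * (\<Sum>e\<in>F. real_of_int (A $$ (i, e)) * u e))"
      by (simp add: sum_distrib_left sum_distrib_right mult.assoc) (rule sum.swap)
    also have "\<dots> \<in> \<int>"
      by (rule Ints_sum, rule Ints_mult) (auto simp: part)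
    finally show ?thesis .
  qed
  then have "B \<noteq> F \<or> F = {}" by (auto simp: F_def)
  then consider (integral) "F = {}" | (fractional) h where "h \<in> F" "h \<notin> B" using B by blast
  then show ?case
  proof cases
    case integral
    then have fl: "real_of_int \<lfloor>u e\<rfloor> = u e" if "e < n" for e
      using that by (auto simp: F_def)
    show ?thesis
    proof (intro exI conjI allI impI)
      show "(\<Sum>e<n. real_of_int (A $$ (i, e)) * real_of_int \<lfloor>u e\<rfloor>) =
          (\<Sum>e<n. real_of_int (A $$ (i, e)) * u e)" for i
        using fl by (intro sum.cong) auto
    qed (auto simp: floor_le_ceiling)
  next
    case fractional
    \<comment> \<open>The dependency that subtracts from column \<open>h\<close> its expansion in
      the columns \<open>B\<close>.\<close>
    define z where "z e = (if e = h then 1 else if e \<in> B then - real_of_int (C e h) else 0)" for e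
    have z0: "z e = 0" if "e \<notin> F" for e
      using that fractional B by (auto simp: z_def)
    have kernel: "(\<Sum>e<n. real_of_int (A $$ (i, e)) * z e) = 0" if i: "i < m" for i
    proof -
      have "(\<Sum>e<n. real_of_int (A $$ (i, e)) * z e) =
          (\<Sum>e\<in>insert h B. real_of_int (A $$ (i, e)) * z e)"
        using fractional B F by (intro sum.mono_neutral_right) (auto simp: z_def)
      also have "\<dots> = real_of_int (A $$ (i, h)) - (\<Sum>e\<in>B. real_of_int (A $$ (i, e)) * real_of_int (C e h))"
        using fractional finB by (simp add: z_def sum_negf[symmetric] cong: sum.cong if_cong)
          (intro sum.cong, auto)
      also have "\<dots> = 0"
        using span[OF i fractional(1)] by simp
      finally show ?thesis .
    qed
    define F' where "F' = {e \<in> F. z e \<noteq> 0}"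
    have F': "finite F'" "F' \<noteq> {}" using finF fractional by (auto simp: F'_def z_def)
    \<comment> \<open>the step along \<open>z\<close> at which coordinate \<open>e\<close> first becomes integral\<close>
    define t where "t e = (if z e > 0 then (\<lceil>u e\<rceil> - u e) / z e else (\<lfloor>u e\<rfloor> - u e) / z e)" for e
    \<comment> \<open>With the smallest step, no coordinate passes its floor or ceiling, and
      coordinate \<open>e0\<close> lands on one of them.\<close>
    obtain e0 where e0: "e0 \<in> F'" and min: "\<And>e. e \<in> F' \<Longrightarrow> t e0 \<le> t e"
      using ex_min_if_finite[of "t ` F'"] F' by (metis arg_min_if_finite(1) arg_min_least)
    define v where "v e = u e + t e0 * z e" for e
    have t_nonneg: "t e \<ge> 0" if "e \<in> F'" for e
      using that by (auto simp: t_def F'_def divide_nonpos_nonpos)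
    have bounds: "\<lfloor>u e\<rfloor> \<le> v e \<and> v e \<le> \<lceil>u e\<rceil>" for e
    proof (cases "e \<in> F'")
      case True
      then have te: "t e0 \<le> t e" and t0: "0 \<le> t e0" and "z e \<noteq> 0"
        using min e0 t_nonneg by (auto simp: F'_def)
      then consider "z e > 0" | "z e < 0" by linarith
      then show ?thesis
      proof cases
        case 1
        then have "t e0 * z e \<le> \<lceil>u e\<rceil> - u e" "0 \<le> t e0 * z e"
          using te t0 by (simp_all add: t_def[of e] pos_le_divide_eq)
        then show ?thesis using of_int_floor_le[of "u e"] unfolding v_def by linarith
      next
        case 2
        then have "\<lfloor>u e\<rfloor> - u e \<le> t e0 * z e" "t e0 * z e \<le> 0"
          using te t0 by (simp_all add: t_def[of e] neg_le_divide_eq mult_nonneg_nonpos)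
        then show ?thesis using le_of_int_ceiling[of "u e"] unfolding v_def by linarith
      qed
    next
      case False
      then have "z e = 0" using z0 by (auto simp: F'_def)
      then show ?thesis by (simp add: v_def)
    qed
    have Av: "(\<Sum>e<n. real_of_int (A $$ (i, e)) * v e) = (\<Sum>e<n. real_of_int (A $$ (i, e)) * u e)"
      if "i < m" for i
    proof -
      have "(\<Sum>e<n. real_of_int (A $$ (i, e)) * v e) =
          (\<Sum>e<n. real_of_int (A $$ (i, e)) * u e) + t e0 * (\<Sum>e<n. real_of_int (A $$ (i, e)) * z e)"
        by (simp add: v_def distrib_left sum.distrib sum_distrib_left mult.left_commute)
      then show ?thesis using kernel[OF that] by simp
    qed
    have "v e0 \<in> \<int>"
      using e0 by (auto simp: v_def t_def F'_def)
    \<comment> \<open>Integral coordinates lie outside \<open>F\<close>, where \<open>z\<close>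
      vanishes, so none of them becomes fractional.\<close>
    moreover have "v e \<in> \<int>" if "u e \<in> \<int>" for e
      using that z0[of e] by (auto simp: v_def F_def)
    ultimately have "{e. e < n \<and> v e \<notin> \<int>} \<subset> {e. e < n \<and> u e \<notin> \<int>}"
      using e0 by (auto simp: F'_def F_def)
    then have "card {e. e < n \<and> v e \<notin> \<int>} < card {e. e < n \<and> u e \<notin> \<int>}"
      by (intro psubset_card_mono) auto
    from less.hyps[OF this] less.prems Av obtain w :: "nat \<Rightarrow> int" where
      w: "\<forall>i<m. (\<Sum>e<n. real_of_int (A $$ (i, e)) * real_of_int (w e)) =
            (\<Sum>e<n. real_of_int (A $$ (i, e)) * v e)"
      and wb: "\<forall>e<n. \<lfloor>v e\<rfloor> \<le> w e \<and> w e \<le> \<lceil>v e\<rceil>" by auto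
    \<comment> \<open>Since \<open>v\<close> stays between the integer bounds of \<open>u\<close>, a
      rounding of \<open>v\<close> is also one of \<open>u\<close>.\<close>
    have "\<lfloor>u e\<rfloor> \<le> \<lfloor>v e\<rfloor>" "\<lceil>v e\<rceil> \<le> \<lceil>u e\<rceil>" for e
      using bounds[of e] by (auto simp: le_floor_iff ceiling_le_iff)
    then have "\<lfloor>u e\<rfloor> \<le> w e \<and> w e \<le> \<lceil>u e\<rceil>" if "e < n" for e
      using wb that by (meson order_trans)
    then show ?thesis using w Av by (intro exI[of _ w]) auto
  qed
qed

section \<open>Flows over abelian groups\<close>

context comm_group
begin

lemma finprod_int_pow:
  fixes a :: "'i \<Rightarrow> int"
  assumes "x \<in> S \<rightarrow> carrier G"
  shows "(\<Otimes>e\<in>S. x e [^] (c * a e)) = (\<Otimes>e\<in>S. x e [^] a e) [^] c"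
  using assms
proof (induction S rule: infinite_finite_induct)
  case (insert e S)
  have "x e [^] (c * a e) = (x e [^] a e) [^] c"
    using insert.prems by (simp add: int_pow_pow mult.commute)
  then show ?case using insert
    by (simp add: Pi_iff int_pow_distrib)
qed simp_all

text \<open>Equations over the group are closed under integer combinations. This transfers integral
  identities between matrices to any abelian group.\<close>

lemma finprod_lincomb_eq_one:
  fixes Q :: "'j \<Rightarrow> 'i \<Rightarrow> int"
  assumes "x \<in> S \<rightarrow> carrier G"
    and "\<And>i. i \<in> I \<Longrightarrow> (\<Otimes>e\<in>S. x e [^] Q i e) = \<one>"
  shows "(\<Otimes>e\<in>S. x e [^] (\<Sum>i\<in>I. l i * Q i e)) = \<one>"
  using assms(2)
proof (induction I rule: infinite_finite_induct)
  case (insert i I)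
  have "(\<Otimes>e\<in>S. x e [^] (\<Sum>i\<in>insert i I. l i * Q i e)) =
      (\<Otimes>e\<in>S. x e [^] (l i * Q i e) \<otimes> x e [^] (\<Sum>i\<in>I. l i * Q i e))"
    using insert.hyps assms(1) by (intro finprod_cong') (auto simp: int_pow_mult Pi_iff)
  also have "\<dots> = (\<Otimes>e\<in>S. x e [^] (l i * Q i e)) \<otimes> (\<Otimes>e\<in>S. x e [^] (\<Sum>i\<in>I. l i * Q i e))"
    using assms(1) by (intro finprod_multf) auto
  also have "\<dots> = \<one>"
    using insert assms(1) finprod_int_pow[OF assms(1)] by simp
  finally show ?case .
qed simp_all

lemma finprod_unit_part:
  fixes C :: "'i \<Rightarrow> int"
  assumes "finite T" "B \<subseteq> T" "b \<in> B" "x \<in> T \<rightarrow> carrier G"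
    and "\<And>b'. b' \<in> B \<Longrightarrow> C b' = of_bool (b = b')"
  shows "(\<Otimes>e\<in>T. x e [^] C e) = x b \<otimes> (\<Otimes>e\<in>T - B. x e [^] C e)"
proof -
  have "(\<Otimes>e\<in>T. x e [^] C e) = (\<Otimes>e\<in>B \<union> (T - B). x e [^] C e)"
    using assms by (simp add: Un_absorb1)
  also have "\<dots> = (\<Otimes>e\<in>B. x e [^] C e) \<otimes> (\<Otimes>e\<in>T - B. x e [^] C e)"
    using assms finite_subset by (intro finprod_Un_disjoint) auto
  also have "(\<Otimes>e\<in>B. x e [^] C e) = (\<Otimes>e\<in>B. if b = e then x e else \<one>)"
    using assms by (intro finprod_cong') (auto simp: Pi_iff)
  also have "\<dots> = x b"
    using assms finite_subset by (intro finprod_singleton) auto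
  finally show ?thesis .
qed

text \<open>The identity block of \<open>C\<close> on \<open>B\<close> lets each equation be solved
  for its own entry \<open>x b\<close>. The values on \<open>T - B\<close> are free and determine
  the rest.\<close>

lemma card_unit_system_solutions:
  fixes C :: "'i \<Rightarrow> 'i \<Rightarrow> int"
  assumes T: "finite T" "T \<subseteq> E" and B: "B \<subseteq> T"
    and C: "\<And>b b'. b \<in> B \<Longrightarrow> b' \<in> B \<Longrightarrow> C b b' = of_bool (b = b')"
  shows "card {x \<in> E \<rightarrow>\<^sub>E carrier G. (\<forall>e\<in>E - T. x e = \<one>) \<and> (\<forall>b\<in>B. (\<Otimes>e\<in>T. x e [^] C b e) = \<one>)}
    = Coset.order G ^ card (T - B)" (is "card ?X = _")
proof -
  let ?Y = "(T - B) \<rightarrow>\<^sub>E carrier G"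
  let ?r = "\<lambda>b y. \<Otimes>e\<in>T - B. y e [^] C b e"
  \<comment> \<open>The inverse of restriction to \<open>T - B\<close>: forced values on
    \<open>B\<close>, the unit on \<open>E - T\<close>.\<close>
  define g where
    "g y = (\<lambda>e\<in>E. if e \<in> B then inv (?r e y) else if e \<in> T then y e else \<one>)" for y
  have r_cong: "?r b y = ?r b y'" if "y' \<in> T - B \<rightarrow> carrier G" "\<And>e. e \<in> T - B \<Longrightarrow> y e = y' e" for b y y'
    using that by (intro finprod_cong') auto
  have split: "(\<Otimes>e\<in>T. x e [^] C b e) = x b \<otimes> ?r b x" if "x \<in> T \<rightarrow> carrier G" "b \<in> B" for x b
    using finprod_unit_part[OF T(1) B that(2,1)] C that by blast
  have "bij_betw (\<lambda>x. restrict x (T - B)) ?X ?Y"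
  proof (rule bij_betw_byWitness[where f' = g])
    show "\<forall>x\<in>?X. g (restrict x (T - B)) = x"
    proof
      fix x assume x: "x \<in> ?X"
      then have xT: "x \<in> T \<rightarrow> carrier G" using T by auto
      have "g (restrict x (T - B)) e = x e" for e
      proof -
        have "x e = inv (?r e (restrict x (T - B)))" if "e \<in> B"
        proof -
          have "x e \<otimes> ?r e x = \<one>" using split[OF xT that] x that by simp
          moreover have "?r e (restrict x (T - B)) = ?r e x"
            using xT by (intro r_cong) auto
          moreover have "?r e x \<in> carrier G" "x e \<in> carrier G"
            using xT that B by (auto intro!: finprod_closed)
          ultimately show ?thesis
            by (simp add: inv_equality)
        qed
        then show ?thesis using x T B by (auto simp: g_def PiE_def extensional_def)
      qed
      then show "g (restrict x (T - B)) = x" by blast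
    qed
    show "\<forall>y\<in>?Y. restrict (g y) (T - B) = y"
      using T by (auto simp: g_def fun_eq_iff restrict_def PiE_def extensional_def)
    show "(\<lambda>x. restrict x (T - B)) ` ?X \<subseteq> ?Y"
      using T by (auto simp: PiE_iff extensional_def split: if_splits)
    show "g ` ?Y \<subseteq> ?X"
    proof clarify
      fix y assume y: "y \<in> ?Y"
      then have rc: "?r b y \<in> carrier G" for b by (intro finprod_closed) (auto simp: PiE_iff)
      have gE: "g y \<in> E \<rightarrow>\<^sub>E carrier G"
        using y rc T by (auto simp: g_def PiE_iff)
      then have gT: "g y \<in> T \<rightarrow> carrier G" using T by auto
      have "(\<Otimes>e\<in>T. g y e [^] C b e) = \<one>" if "b \<in> B" for b
      proof -
        have "?r b (g y) = ?r b y"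
          using y T by (intro r_cong) (auto simp: g_def PiE_iff)
        moreover have "g y b = inv (?r b y)" using that B T by (auto simp: g_def)
        ultimately show ?thesis using split[OF gT that] rc by simp
      qed
      then show "g y \<in> E \<rightarrow>\<^sub>E carrier G \<and> (\<forall>e\<in>E - T. g y e = \<one>) \<and>
          (\<forall>b\<in>B. (\<Otimes>e\<in>T. g y e [^] C b e) = \<one>)"
        using gE B by (auto simp: g_def)
    qed
  qed
  then have "card ?X = card ?Y" by (rule bij_betw_same_card)
  then show ?thesis using T by (simp add: card_PiE Coset.order_def)
qed

end

text \<open>On \<open>T\<close>, the rows of \<open>M\<close> and of \<open>C\<close> are integer
  combinations of each other, with coefficients \<open>L b i\<close> in one direction and
  \<open>M $$ (i, b)\<close> in the other. Both systems thus have the same solutions in every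
  abelian group.\<close>

lemma (in comm_group) card_group_flows_supported:
  assumes M: "M \<in> carrier_mat m n" and T: "T \<subseteq> {..<n}" and B: "B \<subseteq> T"
    and L: "\<And>b e. b \<in> B \<Longrightarrow> e \<in> T \<Longrightarrow> (\<Sum>i<m. L b i * M $$ (i, e)) = C b e"
    and C: "\<And>b b'. b \<in> B \<Longrightarrow> b' \<in> B \<Longrightarrow> C b b' = of_bool (b = b')"
    and span: "\<And>i e. i < m \<Longrightarrow> e \<in> T \<Longrightarrow> M $$ (i, e) = (\<Sum>b\<in>B. M $$ (i, b) * C b e)"
  shows "card {x. group_flow G M x \<and> group_supp G M x \<subseteq> T} = Coset.order G ^ card (T - B)"
proof -
  have finT: "finite T" using T finite_subset by blast
  have "group_flow G M x \<and> group_supp G M x \<subseteq> T \<longleftrightarrow>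
      x \<in> {..<n} \<rightarrow>\<^sub>E carrier G \<and> (\<forall>e\<in>{..<n} - T. x e = \<one>) \<and> (\<forall>b\<in>B. (\<Otimes>e\<in>T. x e [^] C b e) = \<one>)"
    (is "?L \<longleftrightarrow> ?R") for x
  proof (cases "x \<in> {..<n} \<rightarrow>\<^sub>E carrier G \<and> (\<forall>e\<in>{..<n} - T. x e = \<one>)")
    case True
    then have xT: "x \<in> T \<rightarrow> carrier G" using T by auto
    have row: "(\<Otimes>e\<in>{..<n}. x e [^] (M $$ (i, e))) = (\<Otimes>e\<in>T. x e [^] (M $$ (i, e)))" for i
      using True T by (intro finprod_mono_neutral_cong_right) auto
    have "(\<forall>i<m. (\<Otimes>e\<in>T. x e [^] (M $$ (i, e))) = \<one>) \<longleftrightarrow> (\<forall>b\<in>B. (\<Otimes>e\<in>T. x e [^] C b e) = \<one>)"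
    proof (intro iffI ballI allI impI)
      fix b assume *: "\<forall>i<m. (\<Otimes>e\<in>T. x e [^] (M $$ (i, e))) = \<one>" and b: "b \<in> B"
      have "(\<Otimes>e\<in>T. x e [^] C b e) = (\<Otimes>e\<in>T. x e [^] (\<Sum>i<m. L b i * M $$ (i, e)))"
        using xT L b by (intro finprod_cong') auto
      also have "\<dots> = \<one>" using * by (intro finprod_lincomb_eq_one xT) auto
      finally show "(\<Otimes>e\<in>T. x e [^] C b e) = \<one>" .
    next
      fix i assume *: "\<forall>b\<in>B. (\<Otimes>e\<in>T. x e [^] C b e) = \<one>" and i: "i < m"
      have "(\<Otimes>e\<in>T. x e [^] (M $$ (i, e))) = (\<Otimes>e\<in>T. x e [^] (\<Sum>b\<in>B. M $$ (i, b) * C b e))"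
        using xT span i by (intro finprod_cong') auto
      also have "\<dots> = \<one>" using * by (intro finprod_lincomb_eq_one xT) auto
      finally show "(\<Otimes>e\<in>T. x e [^] (M $$ (i, e))) = \<one>" .
    qed
    then show ?thesis using True M row by (auto simp: group_flow_def group_supp_def)
  next
    case False
    then show ?thesis using M by (auto simp: group_flow_def group_supp_def)
  qed
  then have "{x. group_flow G M x \<and> group_supp G M x \<subseteq> T} =
      {x \<in> {..<n} \<rightarrow>\<^sub>E carrier G. (\<forall>e\<in>{..<n} - T. x e = \<one>) \<and> (\<forall>b\<in>B. (\<Otimes>e\<in>T. x e [^] C b e) = \<one>)}"
    by auto
  then show ?thesis using card_unit_system_solutions[OF finT T B C] by simp
qed

section \<open>Counting flows by exact support\<close>

lemma card_group_flows_with_supp_sum: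
  assumes "finite (carrier G)" and "finite S"
  shows "card {x. group_flow G M x \<and> group_supp G M x \<subseteq> S} =
    (\<Sum>T\<in>Pow S. card {x. group_flow G M x \<and> group_supp G M x = T})"
proof -
  have fin: "finite {x. group_flow G M x \<and> P x}" for P
    using assms finite_PiE[of "{..<dim_col M}" "\<lambda>_. carrier G"]
    by (rule_tac finite_subset) (auto simp: group_flow_def)
  have "{x. group_flow G M x \<and> group_supp G M x \<subseteq> S} =
      (\<Union>T\<in>Pow S. {x. group_flow G M x \<and> group_supp G M x = T})" by auto
  then show ?thesis using fin assms by (simp only:) (subst card_UN_disjoint, auto)
qed

text \<open>The counts of flows supported inside \<open>S\<close> agree; by induction so do the
  counts for each proper subset as exact support, and subtracting these leaves the count for
  \<open>S\<close>.\<close>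

lemma card_group_flows_with_supp_eq:
  fixes G :: "('a, 'b) monoid_scheme" and H :: "('c, 'd) monoid_scheme"
  assumes M: "M \<in> carrier_mat m n" and tu: "totally_unimodular M"
    and "comm_group G" "comm_group H" and fin: "finite (carrier G)" "finite (carrier H)"
    and ord: "Coset.order G = Coset.order H"
    and S: "S \<subseteq> {..<n}"
  shows "card {x. group_flow G M x \<and> group_supp G M x = S} =
    card {x. group_flow H M x \<and> group_supp H M x = S}"
proof -
  interpret G: comm_group G by fact
  interpret H: comm_group H by fact
  have "finite S" using S finite_subset by blast
  then show ?thesis using S
  proof (induction S rule: finite_psubset_induct)
    case (psubset S)
    obtain B L C where basis: "B \<subseteq> S"
      "\<And>b e. b \<in> B \<Longrightarrow> e \<in> S \<Longrightarrow> (\<Sum>i<m. L b i * M $$ (i, e)) = C b e"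
      "\<And>b b'. b \<in> B \<Longrightarrow> b' \<in> B \<Longrightarrow> C b b' = of_bool (b = b')"
      "\<And>i e. i < m \<Longrightarrow> e \<in> S \<Longrightarrow> M $$ (i, e) = (\<Sum>b\<in>B. M $$ (i, b) * C b e)"
      by (rule totally_unimodular_column_basis[OF M tu psubset.prems], rule that)
    \<comment> \<open>The basis is chosen from \<open>M\<close> alone and serves both groups, so
      both counts are the same power \<open>card (S - B)\<close> of the common order.\<close>
    have eq: "card {x. group_flow G M x \<and> group_supp G M x \<subseteq> S} =
        card {x. group_flow H M x \<and> group_supp H M x \<subseteq> S}"
      using G.card_group_flows_supported[OF M psubset.prems basis]
        H.card_group_flows_supported[OF M psubset.prems basis] ord by simp
    have Pow: "Pow S = insert S (Pow S - {S})" by auto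
    have "(\<Sum>T\<in>Pow S - {S}. card {x. group_flow G M x \<and> group_supp G M x = T}) =
        (\<Sum>T\<in>Pow S - {S}. card {x. group_flow H M x \<and> group_supp H M x = T})"
      using psubset.prems by (intro sum.cong psubset.IH) auto
    moreover have "(\<Sum>T\<in>Pow S. card {x. group_flow G M x \<and> group_supp G M x = T}) =
        (\<Sum>T\<in>Pow S. card {x. group_flow H M x \<and> group_supp H M x = T})"
      using eq by (simp add: card_group_flows_with_supp_sum fin psubset.hyps)
    ultimately show ?case
      using psubset.hyps by (simp add: sum.remove[of "Pow S" S])
  qed
qed

lemma group_flow_same_supp:
  fixes G :: "('a, 'b) monoid_scheme" and H :: "('c, 'd) monoid_scheme"
  assumes "M \<in> carrier_mat m n" "totally_unimodular M"
    and "comm_group G" "comm_group H" and fin: "finite (carrier G)" "finite (carrier H)"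
    and "Coset.order G = Coset.order H" and x: "group_flow G M x"
  obtains y where "group_flow H M y" "group_supp H M y = group_supp G M x"
proof -
  let ?S = "group_supp G M x"
  let ?X = "{y. group_flow G M y \<and> group_supp G M y = ?S}"
  \<comment> \<open>Needed because \<open>card\<close> of an infinite set is 0: only for a finite
    set does the given flow make the count nonzero.\<close>
  have "finite ?X"
    using fin(1) finite_PiE[of "{..<dim_col M}" "\<lambda>_. carrier G"]
    by (rule_tac finite_subset) (auto simp: group_flow_def)
  then have "card ?X \<noteq> 0" using x by auto
  moreover have "?S \<subseteq> {..<n}" using assms(1) by (auto simp: group_supp_def)
  ultimately have "card {y. group_flow H M y \<and> group_supp H M y = ?S} \<noteq> 0"
    using card_group_flows_with_supp_eq[OF assms(1-7)] by simp
  then have "{y. group_flow H M y \<and> group_supp H M y = ?S} \<noteq> {}" by (metis card.empty)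
  then show thesis using that by blast
qed

section \<open>Flows over cyclic groups as congruences\<close>

lemma finprod_integer_mod_group:
  assumes "f \<in> S \<rightarrow> carrier (integer_mod_group k)"
  shows "finprod (integer_mod_group k) f S = (\<Sum>e\<in>S. f e) mod int k"
proof -
  interpret comm_group "integer_mod_group k" by simp
  show ?thesis using assms
    by (induction S rule: infinite_finite_induct) (simp_all add: mod_add_right_eq)
qed

text \<open>For \<open>k > 0\<close> the group elements are the residues in
  \<open>{0..<int k}\<close>, so a flow is already an integer lift of itself;
  \<open>integer_mod_group 0\<close> would be the group of all integers.\<close>

lemma group_flow_integer_mod_group_iff:
  assumes "M \<in> carrier_mat m n" "k > 0"
  shows "group_flow (integer_mod_group k) M x \<longleftrightarrow>
    x \<in> {..<n} \<rightarrow>\<^sub>E {0..<int k} \<and> (\<forall>i<m. int k dvd (\<Sum>e<n. M $$ (i, e) * x e))"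
proof -
  have "finprod (integer_mod_group k) (\<lambda>e. x e [^]\<^bsub>integer_mod_group k\<^esub> (M $$ (i, e))) {..<n} =
      (\<Sum>e<n. M $$ (i, e) * x e) mod int k" for i
    using assms(2) by (subst finprod_integer_mod_group)
      (auto simp: int_pow_integer_mod_group carrier_integer_mod_group mod_sum_eq)
  then show ?thesis using assms
    by (auto simp: group_flow_def carrier_integer_mod_group mod_eq_0_iff_dvd)
qed

section \<open>NL-flows\<close>

lemma mult_mat_vec_eq_zero_iff:
  assumes "M \<in> carrier_mat m n" "y \<in> carrier_vec n"
  shows "M *\<^sub>v y = 0\<^sub>v m \<longleftrightarrow> (\<forall>i<m. (\<Sum>e<n. M $$ (i, e) * y $ e) = 0)"
proof -
  have "(M *\<^sub>v y) $ i = (\<Sum>e<n. M $$ (i, e) * y $ e)" if "i < m" for i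
    using assms that by (auto simp: scalar_prod_def lessThan_atLeast0 intro!: sum.cong)
  then show ?thesis using assms by (auto simp: vec_eq_iff)
qed

lemma NL_group_flow_same_order:
  fixes G :: "('a, 'b) monoid_scheme" and H :: "('c, 'd) monoid_scheme"
  assumes "M \<in> carrier_mat m n" "totally_unimodular M"
    and "comm_group G" "comm_group H" "finite (carrier G)" "finite (carrier H)"
    and "Coset.order G = Coset.order H" and x: "NL_group_flow G M x"
  shows "\<exists>y. NL_group_flow H M y"
proof -
  obtain y where "group_flow H M y" "group_supp H M y = group_supp G M x"
    using group_flow_same_supp[OF assms(1-7), of x] x by (auto simp: NL_group_flow_def)
  then show ?thesis using x by (auto simp: NL_group_flow_def)
qed

lemma NL_mod_flow_imp_NL_k_flow:
  assumes M: "M \<in> carrier_mat m n" and tu: "totally_unimodular M" and k: "k > 0"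
    and x: "NL_group_flow (integer_mod_group k) M x"
  shows "\<exists>y. NL_k_flow k M y"
proof -
  have xr: "0 \<le> x e" "x e < int k" if "e < n" for e
    using x that by (auto simp: NL_group_flow_def group_flow_integer_mod_group_iff[OF M k] PiE_iff)
  have xd: "int k dvd (\<Sum>e<n. M $$ (i, e) * x e)" if "i < m" for i
    using x that by (auto simp: NL_group_flow_def group_flow_integer_mod_group_iff[OF M k])
  \<comment> \<open>Divisibility of the row sums by \<open>k\<close> is exactly integrality of the
    image of \<open>u\<close>, as rounding requires.\<close>
  define u where "u e = real_of_int (x e) / real k" for e
  have Mu: "(\<Sum>e<n. real_of_int (M $$ (i, e)) * u e) = real_of_int (\<Sum>e<n. M $$ (i, e) * x e) / real k" for i
    by (simp add: u_def sum_divide_distrib)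
  have "(\<Sum>e<n. real_of_int (M $$ (i, e)) * u e) \<in> \<int>" if "i < m" for i
  proof -
    from xd[OF that] obtain c where "(\<Sum>e<n. M $$ (i, e) * x e) = int k * c" unfolding dvd_def by blast
    then have "(\<Sum>e<n. real_of_int (M $$ (i, e)) * u e) = real_of_int c" using k by (simp add: Mu)
    then show ?thesis by simp
  qed
  from totally_unimodular_rounding[OF M tu this] obtain w :: "nat \<Rightarrow> int" where
    w: "\<And>i. i < m \<Longrightarrow> (\<Sum>e<n. real_of_int (M $$ (i, e)) * real_of_int (w e)) =
            (\<Sum>e<n. real_of_int (M $$ (i, e)) * u e)"
    and wb: "\<And>e. e < n \<Longrightarrow> \<lfloor>u e\<rfloor> \<le> w e \<and> w e \<le> \<lceil>u e\<rceil>" by auto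
  define y where "y = vec n (\<lambda>e. x e - int k * w e)"
  have dim: "dim_vec y = n" by (simp add: y_def)
  \<comment> \<open>A zero entry has \<open>u e = 0\<close>, which forces \<open>w e = 0\<close>.
    For any other entry \<open>w e\<close> is 0 or 1, so \<open>y $ e\<close> is \<open>x e\<close>
    or \<open>x e - int k\<close>, nonzero and of absolute value below \<open>k\<close>.\<close>
  have y: "\<bar>y $ e\<bar> \<le> int k - 1 \<and> (y $ e \<noteq> 0 \<longleftrightarrow> x e \<noteq> 0)" if e: "e < n" for e
  proof (cases "x e = 0")
    case True
    then have "w e = 0" using wb[OF e] by (simp add: u_def)
    then show ?thesis using True e k by (simp add: y_def)
  next
    case False
    have "0 < u e" "u e < 1" using False xr[OF e] k by (auto simp: u_def)
    then have "\<lfloor>u e\<rfloor> = 0" "\<lceil>u e\<rceil> = 1" by (auto simp: floor_unique ceiling_unique)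
    then have "w e = 0 \<or> w e = 1" using wb[OF e] by auto
    then show ?thesis using False e xr[OF e] by (auto simp: y_def)
  qed
  have "(\<Sum>e<n. M $$ (i, e) * y $ e) = 0" if i: "i < m" for i
  proof -
    have "(\<Sum>e<n. M $$ (i, e) * y $ e) = (\<Sum>e<n. M $$ (i, e) * x e) - int k * (\<Sum>e<n. M $$ (i, e) * w e)"
      by (simp add: y_def sum_distrib_left sum_subtractf[symmetric] algebra_simps)
    moreover have "real k * (\<Sum>e<n. real_of_int (M $$ (i, e)) * real_of_int (w e)) =
        real_of_int (\<Sum>e<n. M $$ (i, e) * x e)"
      using k by (simp add: w[OF i] Mu)
    then have "real_of_int (int k * (\<Sum>e<n. M $$ (i, e) * w e)) = real_of_int (\<Sum>e<n. M $$ (i, e) * x e)"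
      by simp
    then have "int k * (\<Sum>e<n. M $$ (i, e) * w e) = (\<Sum>e<n. M $$ (i, e) * x e)"
      by (simp only: of_int_eq_iff)
    ultimately show ?thesis by simp
  qed
  then have "M *\<^sub>v y = 0\<^sub>v m"
    using mult_mat_vec_eq_zero_iff[OF M, of y] by (simp add: y_def)
  moreover have "int_supp y = group_supp (integer_mod_group k) M x"
    using y M by (auto simp: int_supp_def group_supp_def dim)
  ultimately have "NL_k_flow k M y"
    using y x M by (auto simp: NL_k_flow_def NL_group_flow_def y_def)
  then show ?thesis ..
qed

text \<open>Reduction modulo \<open>k\<close> keeps the support, since 0 is the only multiple of
  \<open>k\<close> of absolute value at most \<open>k - 1\<close>.\<close>

lemma NL_k_flow_imp_NL_mod_flow:
  assumes M: "M \<in> carrier_mat m n" and k: "k > 0" and y: "NL_k_flow k M y"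
  shows "\<exists>x. NL_group_flow (integer_mod_group k) M x"
proof -
  have yc: "y \<in> carrier_vec n" and yb: "\<And>e. e < n \<Longrightarrow> \<bar>y $ e\<bar> \<le> int k - 1"
    and My: "\<And>i. i < m \<Longrightarrow> (\<Sum>e<n. M $$ (i, e) * y $ e) = 0"
    using y M mult_mat_vec_eq_zero_iff[OF M, of y] by (auto simp: NL_k_flow_def)
  define x where "x = (\<lambda>e\<in>{..<n}. y $ e mod int k)"
  have "int k dvd (\<Sum>e<n. M $$ (i, e) * x e)" if "i < m" for i
  proof -
    have "(\<Sum>e<n. M $$ (i, e) * x e) mod int k = (\<Sum>e<n. M $$ (i, e) * (y $ e mod int k) mod int k) mod int k"
      by (simp add: x_def mod_sum_eq)
    also have "\<dots> = (\<Sum>e<n. M $$ (i, e) * y $ e) mod int k"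
      by (simp add: mod_mult_right_eq mod_sum_eq)
    finally show ?thesis using My[OF that] by (simp add: mod_eq_0_iff_dvd)
  qed
  then have "group_flow (integer_mod_group k) M x"
    using k by (auto simp: group_flow_integer_mod_group_iff[OF M k] x_def)
  moreover have "y $ e mod int k = 0 \<longleftrightarrow> y $ e = 0" if "e < n" for e
    using yb[OF that] zdvd_not_zless[of "\<bar>y $ e\<bar>" "int k"] by (auto simp: mod_eq_0_iff_dvd)
  then have "group_supp (integer_mod_group k) M x = int_supp y"
    using M yc by (auto simp: group_supp_def int_supp_def x_def)
  ultimately show ?thesis using y by (auto simp: NL_group_flow_def NL_k_flow_def)
qed

theorem theorem6:
  fixes M :: "int mat" and m n k :: nat and G :: "('a, 'b) monoid_scheme"
  assumes "M \<in> carrier_mat m n"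
    and "elements_mat M \<subseteq> {-1, 0, 1}"
    and "totally_unimodular M"
    and "k \<ge> 2"
    and "comm_group G" and "Coset.order G = k"
  shows "((\<exists>x. NL_group_flow (integer_mod_group k) M x) \<longleftrightarrow> (\<exists>x. NL_group_flow G M x))
       \<and> ((\<exists>x. NL_group_flow G M x) \<longleftrightarrow> (\<exists>x. NL_k_flow k M x))"
proof -
  let ?Z = "integer_mod_group k"
  have k: "k > 0" using assms(4) by simp
  have Z: "comm_group ?Z" "finite (carrier ?Z)" "Coset.order ?Z = k"
    using k by (simp_all add: carrier_integer_mod_group Coset.order_def)
  \<comment> \<open>An infinite carrier would have order 0, contradicting
    \<open>k > 0\<close>.\<close>
  have G: "finite (carrier G)"
    using assms(6) k by (auto simp: Coset.order_def intro: card_ge_0_finite)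
  have "(\<exists>x. NL_group_flow ?Z M x) \<longleftrightarrow> (\<exists>x. NL_group_flow G M x)"
    using NL_group_flow_same_order[OF assms(1,3) Z(1) assms(5) Z(2) G]
      NL_group_flow_same_order[OF assms(1,3) assms(5) Z(1) G Z(2)] Z(3) assms(6) by auto
  moreover have "(\<exists>x. NL_group_flow ?Z M x) \<longleftrightarrow> (\<exists>y. NL_k_flow k M y)"
    using NL_mod_flow_imp_NL_k_flow[OF assms(1,3) k] NL_k_flow_imp_NL_mod_flow[OF assms(1) k] by blast
  ultimately show ?thesis by blast
qed

end
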